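(* Let $A\in\mathbb{R}^{m\times n}$ have full row rank $m$, let $B_k\in\mathbb{R}^{n\times n}$ be the (positive definite) L-BFGS matrix described in the context, and let $V_k\in\mathbb{R}^{n\times n}$ be the $(1,1)$ block of the inverse of the KKT matrix $$\begin{bmatrix} B_k & A^\top\\ A & 0_{m\times m}\end{bmatrix},$$ that is, $$V_k = B_k^{-1}-B_k^{-1}A^\top (AB_k^{-1}A^\top)^{-1}AB_k^{-1}.$$ Let $P = I_n - A^\top(AA^\top)^{-1}A$ be the orthogonal projection onto the nullspace of $A$. Then $$V_k = V_kP = P^\top V_k = P^\top V_k P .$$
   Context: Setting: minimize $f(x)$ subject to $Ax=b$, with $f:\mathbb{R}^n\to\mathbb{R}$ and gradient $g$. Iterates $x_i$ are feasible ($Ax_i=b$). Put $s_i=x_{i+1}-x_i$ and $y_i=g(x_{i+1})-g(x_i)$, so $As_i=0$. For a memory parameter $l$ with $1\le l\le k$, let $S_k=[\,s_{k-l},\dots,s_{k-1}\,]\in\mathbb{R}^{n\times l}$ and $Y_k=[\,y_{k-l},\dots,y_{k-1}\,]\in\mathbb{R}^{n\times l}$. Write $S_k^\top Y_k=L_k+D_k+\bar T_k$ with $L_k$ strictly lower triangular, $D_k$ diagonal, $\bar T_k$ strictly upper triangular. Let $\gamma_k>0$, $\delta_k=1/\gamma_k$, $J_k=[\,S_k\ \ Y_k\,]$. The L-BFGS matrix is $$B_k=\gamma_k I+J_kM_kJ_k^\top,\qquad M_k=-\begin{bmatrix}\delta_kS_k^\top S_k&\delta_kL_k\\ \delta_kL_k^\top&-D_k\end{bmatrix}^{-1}.$$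 Standing assumptions: the inverse defining $M_k$ exists, $D_k$ is nonsingular, and $B_k$ is positive definite. *)

theory Defs
  imports "HOL-Analysis.Analysis"
begin

text \<open>
  Matrices in $R^{p \times q}$ have type \<open>real ^ 'q ^ 'p\<close>; the memory parameter $l$ is \<open>CARD('l)\<close>
  for a finite linearly ordered index type \<open>'l\<close>, the order being needed to speak of
  triangular parts and of consecutive columns.
\<close>

definition positive_definite :: "real ^ 'n ^ 'n \<Rightarrow> bool" where
  "positive_definite B \<longleftrightarrow> transpose B = B \<and> (\<forall>v. v \<noteq> 0 \<longrightarrow> 0 < v \<bullet> (B *v v))"

subsection \<open>Block matrices\<close>

definition block_mat ::
  "real ^ 'a ^ 'c \<Rightarrow> real ^ 'b ^ 'c \<Rightarrow> real ^ 'a ^ 'd \<Rightarrow> real ^ 'b ^ 'd \<Rightarrow> real ^ ('a + 'b) ^ ('c + 'd)"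
where
  "block_mat P Q R T = (\<chi> i j. case i of
      Inl a \<Rightarrow> (case j of Inl c \<Rightarrow> P $ a $ c | Inr d \<Rightarrow> Q $ a $ d)
    | Inr b \<Rightarrow> (case j of Inl c \<Rightarrow> R $ b $ c | Inr d \<Rightarrow> T $ b $ d))"

definition hcat :: "real ^ 'a ^ 'c \<Rightarrow> real ^ 'b ^ 'c \<Rightarrow> real ^ ('a + 'b) ^ 'c" where
  "hcat P Q = (\<chi> i j. case j of Inl c \<Rightarrow> P $ i $ c | Inr d \<Rightarrow> Q $ i $ d)"

definition block11 :: "real ^ ('a + 'b :: finite) ^ ('c + 'd :: finite) \<Rightarrow> real ^ 'a ^ 'c" where
  "block11 K = (\<chi> i j. K $ Inl i $ Inl j)"

definition diag_part :: "real ^ 'l ^ 'l \<Rightarrow> real ^ 'l ^ 'l" where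
  "diag_part W = (\<chi> i j. if i = j then W $ i $ j else 0)"

definition strict_lower_part ::
  "real ^ ('l :: {finite, linorder}) ^ ('l :: {finite, linorder}) \<Rightarrow> real ^ ('l :: {finite, linorder}) ^ ('l :: {finite, linorder})" where
  "strict_lower_part W = (\<chi> i j. if j < i then W $ i $ j else 0)"

subsection \<open>The L-BFGS matrix\<close>

definition diff_seq :: "(nat \<Rightarrow> 'a :: ab_group_add) \<Rightarrow> nat \<Rightarrow> 'a" where
  "diff_seq u i = u (Suc i) - u i"

text \<open>
  The matrix $[v_{k-l}, \dots, v_{k-1}]$. The number of indices below \<open>j\<close> is the
  zero-based position of the column \<open>j\<close>; the subtraction is meant for $l \le k$ only.
\<close>

definition memory_mat ::
  "(nat \<Rightarrow> real ^ 'n) \<Rightarrow> nat \<Rightarrow> real ^ ('l :: {finite, linorder}) ^ 'n" where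
  "memory_mat v k = (\<chi> i j. v (k - CARD('l) + card {j'. j' < j}) $ i)"

text \<open>The matrix whose negated inverse is the middle factor $M_k$.\<close>

definition lbfgs_core ::
  "real \<Rightarrow> real ^ ('l :: {finite, linorder}) ^ 'n \<Rightarrow> real ^ ('l :: {finite, linorder}) ^ 'n
    \<Rightarrow> real ^ ('l + 'l) ^ ('l + 'l)"
where
  "lbfgs_core \<gamma> S Y =
    (let \<delta> = 1 / \<gamma>;
         L = strict_lower_part (transpose S ** Y);
         D = diag_part (transpose S ** Y)
     in block_mat (\<delta> *\<^sub>R (transpose S ** S)) (\<delta> *\<^sub>R L)
                  (\<delta> *\<^sub>R transpose L)          (- D))"

definition lbfgs_matrix ::
  "real \<Rightarrow> real ^ ('l :: {finite, linorder}) ^ 'n \<Rightarrow> real ^ ('l :: {finite, linorder}) ^ 'n \<Rightarrow> real ^ 'n ^ 'n"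
where
  "lbfgs_matrix \<gamma> S Y =
    (let J = hcat S Y; M = - matrix_inv (lbfgs_core \<gamma> S Y)
     in \<gamma> *\<^sub>R mat 1 + J ** M ** transpose J)"

subsection \<open>The KKT matrix\<close>

definition kkt_matrix :: "real ^ 'n ^ 'n \<Rightarrow> real ^ 'n ^ 'm \<Rightarrow> real ^ ('n + 'm) ^ ('n + 'm)" where
  "kkt_matrix B A = block_mat B (transpose A) A 0"

end

theory Submission
  imports Defs
begin

text \<open>
  The argument rests on positive definiteness of \<open>B\<close>. Write \<open>G\<close> for the Schur
  complement \<open>A ** matrix_inv B ** transpose A\<close>. Full row rank of
  \<open>A\<close> means that \<open>transpose A\<close> is injective, so the congruence
  \<open>A ** C ** transpose A\<close> inherits positive definiteness from \<open>C\<close>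
  (\<open>positive_definite_congruence\<close>). With \<open>C = matrix_inv B\<close> this makes \<open>G\<close> invertible,
  and block elimination exhibits the inverse of the KKT matrix (\<open>kkt_inverse\<close>), whose leading
  block is the stated formula for \<open>V\<close>. With \<open>C = mat 1\<close> it makes \<open>A ** transpose A\<close>
  invertible, so that \<open>P\<close> really is the orthogonal projection onto the null space of \<open>A\<close>
  (\<open>nullspace_projection\<close>).

  The absorption identities hold because \<open>V\<close> annihilates the range of \<open>transpose A\<close>:
  in \<open>A ** V\<close> the factor \<open>G\<close> appears and cancels against its inverse, and \<open>V\<close> is
  symmetric, so \<open>V ** transpose A\<close> vanishes together with \<open>A ** V\<close>. As
  \<open>P\<close> differs from the identity by a matrix with left factor \<open>transpose A\<close>, this gives
  \<open>V ** P = V\<close>; transposing, with \<open>V\<close> symmetric, gives the identities on the other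
  side.
\<close>

section \<open>Matrix algebra\<close>

lemma matrix_diff_ldistrib:
  fixes A :: "real ^ 'n ^ 'm"
  shows "A ** (B - C) = A ** B - A ** C"
  by (vector matrix_matrix_mult_def sum_subtractf right_diff_distrib)

lemma matrix_minus_right:
  fixes A :: "real ^ 'n ^ 'm"
  shows "A ** (- B) = - (A ** B)"
  by (vector matrix_matrix_mult_def sum_negf)

lemma matrix_zero_left: "(0 :: real ^ 'n ^ 'm) ** A = 0"
  by (vector matrix_matrix_mult_def)

lemma transpose_diff:
  fixes A B :: "real ^ 'n ^ 'm"
  shows "transpose (A - B) = transpose A - transpose B"
  by (vector transpose_def)

lemma matrix_inverse_cancel:
  fixes A :: "real ^ 'n ^ 'n"
  assumes "invertible A"
  shows "A ** matrix_inv A = mat 1" and "matrix_inv A ** A = mat 1"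
proof -
  have "\<exists>A'. A ** A' = mat 1 \<and> A' ** A = mat 1"
    using assms by (simp add: invertible_def)
  then have "A ** matrix_inv A = mat 1 \<and> matrix_inv A ** A = mat 1"
    unfolding matrix_inv_def by (rule someI_ex)
  then show "A ** matrix_inv A = mat 1" and "matrix_inv A ** A = mat 1" by simp_all
qed

lemma matrix_inverse_unique:
  fixes A C :: "real ^ 'n ^ 'n"
  assumes "A ** C = mat 1"
  shows "invertible A" and "matrix_inv A = C"
proof -
  show inv: "invertible A"
    using assms invertible_right_inverse by blast
  have "matrix_inv A = matrix_inv A ** (A ** C)"
    by (simp add: assms)
  also have "\<dots> = C"
    by (simp add: matrix_mul_assoc matrix_inverse_cancel(2)[OF inv])
  finally show "matrix_inv A = C" .
qed

lemma transpose_matrix_inv_symmetric: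
  fixes A :: "real ^ 'n ^ 'n"
  assumes "invertible A" and "transpose A = A"
  shows "transpose (matrix_inv A) = matrix_inv A"
proof -
  have "transpose (matrix_inv A ** A) = mat 1"
    by (simp add: matrix_inverse_cancel(2)[OF assms(1)])
  then have "A ** transpose (matrix_inv A) = mat 1"
    by (simp add: matrix_transpose_mul assms(2))
  from matrix_inverse_unique(2)[OF this] show ?thesis by simp
qed

section \<open>Block matrices\<close>

lemma sum_UNIV_Plus:
  fixes h :: "'a :: finite + 'b :: finite \<Rightarrow> real"
  shows "(\<Sum>i\<in>UNIV. h i) = (\<Sum>a\<in>UNIV. h (Inl a)) + (\<Sum>b\<in>UNIV. h (Inr b))"
  unfolding UNIV_Plus_UNIV[symmetric] by (subst sum.Plus) simp_all

lemma block_mat_mult: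
  "block_mat P Q R T ** block_mat P' Q' R' T' =
    block_mat (P ** P' + Q ** R') (P ** Q' + Q ** T') (R ** P' + T ** R') (R ** Q' + T ** T')"
  by (simp add: block_mat_def matrix_matrix_mult_def vec_eq_iff sum_UNIV_Plus split: sum.split)

lemma block_mat_identity: "block_mat (mat 1) 0 0 (mat 1) = mat 1"
  by (simp add: block_mat_def mat_def vec_eq_iff split: sum.split)

lemma block11_block_mat: "block11 (block_mat P Q R T) = P"
  by (simp add: block11_def block_mat_def vec_eq_iff)

section \<open>Positive definite matrices\<close>

lemma inner_transpose_mult:
  fixes A :: "real ^ 'n ^ 'm"
  shows "(transpose A *v w) \<bullet> v = w \<bullet> (A *v v)"
  by (simp add: dot_lmul_matrix)

lemma positive_definite_mat_1: "positive_definite (mat 1)"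
  by (simp add: positive_definite_def)

lemma positive_definite_invertible:
  assumes "positive_definite B"
  shows "invertible B"
proof -
  have "v = 0" if "B *v v = 0" for v
    using assms that unfolding positive_definite_def by (metis inner_zero_right less_irrefl)
  then show ?thesis
    unfolding invertible_left_inverse using matrix_left_invertible_ker[of B] by blast
qed

text \<open>
  The substitution \<open>v = B *v w\<close> turns the quadratic form of the inverse into that of \<open>B\<close>.
\<close>

lemma positive_definite_matrix_inv:
  assumes "positive_definite B"
  shows "positive_definite (matrix_inv B)"
  unfolding positive_definite_def
proof (intro conjI allI impI)
  have inv: "invertible B"
    by (rule positive_definite_invertible[OF assms])
  have sym: "transpose B = B"
    using assms by (simp add: positive_definite_def)
  show "transpose (matrix_inv B) = matrix_inv B"
    by (rule transpose_matrix_inv_symmetric[OF inv sym])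
  fix v :: "real ^ 'a"
  assume "v \<noteq> 0"
  define w where "w = matrix_inv B *v v"
  have v: "v = B *v w"
    by (simp add: w_def matrix_vector_mul_assoc matrix_inverse_cancel(1)[OF inv])
  with \<open>v \<noteq> 0\<close> have "w \<noteq> 0" by auto
  with assms have "0 < w \<bullet> (B *v w)"
    by (simp add: positive_definite_def)
  then show "0 < v \<bullet> (matrix_inv B *v v)"
    unfolding w_def[symmetric] by (subst v) (simp add: inner_commute)
qed

text \<open>
  A vector in the kernel of \<open>transpose A\<close> is orthogonal to the range of \<open>A\<close>, which is
  the whole space.
\<close>

lemma full_row_rank_transpose_injective:
  fixes A :: "real ^ 'n ^ 'm"
  assumes "rank A = CARD('m)" and "transpose A *v w = 0"
  shows "w = 0"
proof -
  have "surj ((*v) A)"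
    using assms(1) full_rank_surjective by blast
  then obtain v where "w = A *v v" by (metis surjD)
  then have "w \<bullet> w = (transpose A *v w) \<bullet> v"
    by (metis inner_transpose_mult)
  with assms(2) show ?thesis by simp
qed

lemma positive_definite_congruence:
  fixes A :: "real ^ 'n ^ 'm"
  assumes "positive_definite C" and "rank A = CARD('m)"
  shows "positive_definite (A ** C ** transpose A)"
  unfolding positive_definite_def
proof (intro conjI allI impI)
  show "transpose (A ** C ** transpose A) = A ** C ** transpose A"
    using assms(1) by (simp add: positive_definite_def matrix_transpose_mul matrix_mul_assoc)
  fix w :: "real ^ 'm"
  assume "w \<noteq> 0"
  then have "transpose A *v w \<noteq> 0"
    using full_row_rank_transpose_injective[OF assms(2)] by blast
  then have "0 < (transpose A *v w) \<bullet> (C *v (transpose A *v w))"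
    using assms(1) unfolding positive_definite_def by blast
  also have "\<dots> = w \<bullet> ((A ** C ** transpose A) *v w)"
    by (simp only: inner_transpose_mult matrix_vector_mul_assoc matrix_mul_assoc)
  finally show "0 < w \<bullet> ((A ** C ** transpose A) *v w)" .
qed

section \<open>The null-space projection\<close>

definition nullspace_proj :: "real ^ 'n ^ 'm \<Rightarrow> real ^ 'n ^ 'n" where
  "nullspace_proj A = mat 1 - transpose A ** matrix_inv (A ** transpose A) ** A"

lemma gram_invertible:
  fixes A :: "real ^ 'n ^ 'm"
  assumes "rank A = CARD('m)"
  shows "invertible (A ** transpose A)"
  using positive_definite_invertible[OF positive_definite_congruence[OF positive_definite_mat_1 assms]]
  by simp

text \<open>
  The residual \<open>u - P *v u\<close> lies in the range of \<open>transpose A\<close>, the orthogonal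
  complement of the null space.
\<close>

lemma nullspace_projection:
  fixes A :: "real ^ 'n ^ 'm"
  assumes "rank A = CARD('m)"
  shows "A *v (nullspace_proj A *v u) = 0"
    and "A *v z = 0 \<Longrightarrow> orthogonal (u - nullspace_proj A *v u) z"
proof -
  have "A ** nullspace_proj A = 0"
    by (simp add: nullspace_proj_def matrix_diff_ldistrib matrix_mul_assoc
        matrix_inverse_cancel(1)[OF gram_invertible[OF assms]])
  then show "A *v (nullspace_proj A *v u) = 0"
    by (simp add: matrix_vector_mul_assoc)
  assume z: "A *v z = 0"
  have "u - nullspace_proj A *v u = transpose A *v (matrix_inv (A ** transpose A) *v (A *v u))"
    by (simp only: nullspace_proj_def matrix_vector_mult_diff_rdistrib matrix_vector_mul_lid
        matrix_vector_mul_assoc matrix_mul_assoc) simp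
  then show "orthogonal (u - nullspace_proj A *v u) z"
    by (simp only: orthogonal_def inner_transpose_mult z inner_zero_right)
qed

lemma mult_nullspace_proj_absorb:
  fixes A :: "real ^ 'n ^ 'm"
  assumes "V ** transpose A = 0"
  shows "V ** nullspace_proj A = V"
  using assms by (simp add: nullspace_proj_def matrix_diff_ldistrib matrix_mul_assoc matrix_zero_left)

section \<open>Inverting the KKT matrix\<close>

definition kkt_block :: "real ^ 'n ^ 'n \<Rightarrow> real ^ 'n ^ 'm \<Rightarrow> real ^ 'n ^ 'n" where
  "kkt_block B A = matrix_inv B - matrix_inv B ** transpose A
     ** matrix_inv (A ** matrix_inv B ** transpose A) ** A ** matrix_inv B"

lemma schur_invertible:
  fixes A :: "real ^ 'n ^ 'm"
  assumes "positive_definite B" and "rank A = CARD('m)"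
  shows "invertible (A ** matrix_inv B ** transpose A)"
  by (intro positive_definite_invertible positive_definite_congruence
      positive_definite_matrix_inv assms)

lemma transpose_kkt_block:
  fixes A :: "real ^ 'n ^ 'm"
  assumes "positive_definite B" and "rank A = CARD('m)"
  shows "transpose (kkt_block B A) = kkt_block B A"
proof -
  have H: "transpose (matrix_inv B) = matrix_inv B"
    using positive_definite_matrix_inv[OF assms(1)] by (simp add: positive_definite_def)
  have "transpose (matrix_inv (A ** matrix_inv B ** transpose A))
      = matrix_inv (A ** matrix_inv B ** transpose A)"
    by (rule transpose_matrix_inv_symmetric[OF schur_invertible[OF assms]])
       (simp add: matrix_transpose_mul matrix_mul_assoc H)
  with H show ?thesis
    by (simp add: kkt_block_def transpose_diff matrix_transpose_mul matrix_mul_assoc)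
qed

lemma mult_kkt_block_zero:
  fixes A :: "real ^ 'n ^ 'm"
  assumes "positive_definite B" and "rank A = CARD('m)"
  shows "A ** kkt_block B A = 0"
  by (simp add: kkt_block_def matrix_diff_ldistrib matrix_mul_assoc
      matrix_inverse_cancel(1)[OF schur_invertible[OF assms]])

lemma kkt_block_transpose_zero:
  fixes A :: "real ^ 'n ^ 'm"
  assumes "positive_definite B" and "rank A = CARD('m)"
  shows "kkt_block B A ** transpose A = 0"
proof -
  have "transpose (A ** kkt_block B A) = 0"
    by (simp add: mult_kkt_block_zero[OF assms] transpose_def vec_eq_iff)
  then show ?thesis
    by (simp add: matrix_transpose_mul transpose_kkt_block[OF assms])
qed

text \<open>
  The other blocks of the inverse come from eliminating \<open>v\<close> in the system
  \<open>B *v v + transpose A *v w = p\<close>, \<open>A *v v = q\<close>: multiplying the first equation by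
  \<open>A ** matrix_inv B\<close> leaves an equation for \<open>w\<close> with coefficient matrix \<open>G\<close>, the
  Schur complement.
\<close>

lemma kkt_inverse:
  fixes A :: "real ^ 'n ^ 'm"
  assumes "positive_definite B" and "rank A = CARD('m)"
  defines "H \<equiv> matrix_inv B"
    and "N \<equiv> matrix_inv (A ** matrix_inv B ** transpose A)"
  shows "kkt_matrix B A ** block_mat (kkt_block B A) (H ** transpose A ** N) (N ** A ** H) (- N)
    = mat 1"
proof -
  have BH: "B ** H = mat 1"
    unfolding H_def
    by (rule matrix_inverse_cancel(1)[OF positive_definite_invertible[OF assms(1)]])
  have GN: "A ** H ** transpose A ** N = mat 1"
    unfolding H_def N_def by (rule matrix_inverse_cancel(1)[OF schur_invertible[OF assms(1,2)]])
  have "B ** kkt_block B A + transpose A ** (N ** A ** H) = mat 1"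
    unfolding kkt_block_def H_def[symmetric] N_def[unfolded H_def[symmetric], symmetric]
    by (simp add: matrix_diff_ldistrib matrix_mul_assoc BH)
  moreover have "B ** (H ** transpose A ** N) + transpose A ** (- N) = 0"
    by (simp add: matrix_minus_right matrix_mul_assoc BH)
  moreover have "A ** (H ** transpose A ** N) = mat 1"
    by (simp add: matrix_mul_assoc GN)
  ultimately show ?thesis
    by (simp add: kkt_matrix_def block_mat_mult matrix_zero_left mult_kkt_block_zero[OF assms(1,2)]
        block_mat_identity)
qed

section \<open>The KKT block and the projection\<close>

theorem mainTheorem1:
  fixes f :: "real ^ 'n \<Rightarrow> real"
    and g :: "real ^ 'n \<Rightarrow> real ^ 'n"
    and A :: "real ^ 'n ^ 'm"
    and b :: "real ^ 'm"
    and x :: "nat \<Rightarrow> real ^ 'n"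
    and k :: nat
    and \<gamma> :: real
    and S Y :: "real ^ ('l :: {finite, linorder}) ^ 'n"
    and B V P :: "real ^ 'n ^ 'n"
  assumes gradient: "\<And>z. GDERIV f z :> g z"
    and feasible: "\<And>i. A *v x i = b"
    and full_row_rank: "rank A = CARD('m)"
    and memory: "CARD('l) \<le> k"
    and gamma_pos: "\<gamma> > 0"
    and S: "S = memory_mat (diff_seq x) k"
    and Y: "Y = memory_mat (diff_seq (\<lambda>i. g (x i))) k"
    and B: "B = lbfgs_matrix \<gamma> S Y"
    and core_invertible: "invertible (lbfgs_core \<gamma> S Y)"
    and D_invertible: "invertible (diag_part (transpose S ** Y))"
    and B_pos_def: "positive_definite B"
    and V: "V = block11 (matrix_inv (kkt_matrix B A))"
    and P: "P = mat 1 - transpose A ** matrix_inv (A ** transpose A) ** A"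
  shows "invertible (kkt_matrix B A) \<and>
    V = matrix_inv B - matrix_inv B ** transpose A
          ** matrix_inv (A ** matrix_inv B ** transpose A) ** A ** matrix_inv B \<and>
    (\<forall>u. A *v (P *v u) = 0 \<and> (\<forall>z. A *v z = 0 \<longrightarrow> orthogonal (u - P *v u) z)) \<and>
    V = V ** P \<and>
    V ** P = transpose P ** V \<and>
    transpose P ** V = transpose P ** V ** P"
proof (intro conjI allI impI)
  note inverse = matrix_inverse_unique[OF kkt_inverse[OF B_pos_def full_row_rank]]
  show "invertible (kkt_matrix B A)"
    by (rule inverse(1))
  have V_block: "V = kkt_block B A"
    unfolding V inverse(2) block11_block_mat ..
  then show "V = matrix_inv B - matrix_inv B ** transpose A
      ** matrix_inv (A ** matrix_inv B ** transpose A) ** A ** matrix_inv B"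
    unfolding kkt_block_def .
  have P_proj: "P = nullspace_proj A"
    unfolding P nullspace_proj_def ..
  show "A *v (P *v u) = 0" for u
    unfolding P_proj by (rule nullspace_projection(1)[OF full_row_rank])
  show "orthogonal (u - P *v u) z" if "A *v z = 0" for u z
    unfolding P_proj using that by (rule nullspace_projection(2)[OF full_row_rank])
  have VP: "V ** P = V"
    unfolding V_block P_proj
    by (intro mult_nullspace_proj_absorb kkt_block_transpose_zero B_pos_def full_row_rank)
  then show "V = V ** P" ..
  have "transpose (V ** P) = V"
    unfolding VP unfolding V_block by (rule transpose_kkt_block[OF B_pos_def full_row_rank])
  then have PV: "transpose P ** V = V"
    unfolding matrix_transpose_mul V_block transpose_kkt_block[OF B_pos_def full_row_rank] .
  show "V ** P = transpose P ** V"
    unfolding VP PV ..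
  show "transpose P ** V = transpose P ** V ** P"
    unfolding PV VP ..
qed

end
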